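(* Let $(X_i)_{i\in\mathbb Z}$ be the stationary sequence described in the context, and for $t\ge 0$ and $n\geq 1$ let $S_{\alpha,n}(t)=\sum_{k=0}^n\min\{\alpha_{1,\mathbf X}(k),H(t)\}$. Then for every positive integer $n$, $$\mathbb E(W_1(\mu_n,\mu))\le 4\int_0^\infty\sqrt{\min\left\{(H(t))^2,\frac{S_{\alpha,n}(t)}{n}\right\}}\,dt$$ and $$\|W_1(\mu_n,\mu)\|_2\le\frac{2\sqrt2}{\sqrt n}\int_0^\infty\sqrt{S_{\alpha,n}(t)}\,dt .$$
   Context: Setting. $(\Omega,\mathcal A,\mathbb P)$ is a probability space, $T:\Omega\to\Omega$ is a bijective bi-measurable transformation preserving $\mathbb P$, and $\mathcal F_0\subseteq\mathcal A$ is a sub-$\sigma$-algebra with $\mathcal F_0\subseteq T^{-1}(\mathcal F_0)$. $X_0$ is an $\mathcal F_0$-measurable integrable real-valued random variable with distribution $\mu$ and distribution function $F$, and $\mathbf X=(X_i)_{i\in\mathbb Z}$ with $X_i=X_0\circ T^i$. Notation. $\mu_n=\frac1n\sum_{k=1}^n\delta_{X_k}$ is the empirical measure. $W_1(\mu_1,\mu_2)=\inf_\pi\int|x-y|\,\pi(dx,dy)$, the infimum being over probability measures $\pi$ on $\mathbb R^2$ with marginals $\mu_1,\mu_2$. $H(t)=\mathbb P(|X_0|>t)$ for $t\ge0$. For $n\ge 0$, $\alpha_{1,\mathbf X}(n)=\sup_{x\in\mathbb R}\|\mathbb E(\mathbf 1_{X_n\le x}|\mathcal F_0)-F(x)\|_1$.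 $\|\cdot\|_p$ is the norm of $\mathbb L^p(\mathbb P)$. The right-hand sides may be infinite. *)

theory Defs
  imports "HOL-Probability.Probability"
begin

text \<open>Integer iterates of a bijection of the space of \<open>M\<close>. Only the values on
  \<open>space M\<close> are meaningful when the exponent is negative.\<close>

definition int_iterate :: "'a measure \<Rightarrow> ('a \<Rightarrow> 'a) \<Rightarrow> int \<Rightarrow> 'a \<Rightarrow> 'a" where
  "int_iterate M T i =
     (if 0 \<le> i then T ^^ nat i else the_inv_into (space M) T ^^ nat (- i))"

definition bimeasurable_preserving :: "'a measure \<Rightarrow> ('a \<Rightarrow> 'a) \<Rightarrow> bool" where
  "bimeasurable_preserving M T \<longleftrightarrow>
     bij_betw T (space M) (space M) \<and>
     T \<in> measurable M M \<and>
     the_inv_into (space M) T \<in> measurable M M \<and>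
     distr M M T = M"

definition empirical_measure :: "(int \<Rightarrow> 'a \<Rightarrow> real) \<Rightarrow> nat \<Rightarrow> 'a \<Rightarrow> real measure" where
  "empirical_measure X n \<omega> =
     measure_of UNIV (sets borel)
       (\<lambda>A. ennreal (1 / real n) * (\<Sum>k=1..n. emeasure (return borel (X (int k) \<omega>)) A))"

lemma sets_empirical_measure [simp]: "sets (empirical_measure X n \<omega>) = sets borel"
  unfolding empirical_measure_def
  by (metis sets.sets_measure_of_eq space_borel)

lemma space_empirical_measure [simp]: "space (empirical_measure X n \<omega>) = UNIV"
  by (metis sets_empirical_measure sets_eq_imp_space_eq space_borel)

lemma emeasure_empirical_measure:
  assumes "A \<in> sets borel"
  shows "emeasure (empirical_measure X n \<omega>) A =
     ennreal (1 / real n) * (\<Sum>k=1..n. indicator A (X (int k) \<omega>))"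
proof -
  let ?m = "\<lambda>A. ennreal (1 / real n) *
    (\<Sum>k=1..n. emeasure (return borel (X (int k) \<omega>)) (A :: real set))"
  have "countably_additive (sets borel) ?m"
  proof (rule countably_additiveI)
    fix B :: "nat \<Rightarrow> real set"
    assume B: "range B \<subseteq> sets borel" "disjoint_family B"
    have "(\<Sum>i. ?m (B i)) =
        ennreal (1 / real n) * (\<Sum>i. \<Sum>k=1..n. emeasure (return borel (X (int k) \<omega>)) (B i))"
      by (rule ennreal_suminf_cmult)
    also have "(\<Sum>i. \<Sum>k=1..n. emeasure (return borel (X (int k) \<omega>)) (B i)) =
        (\<Sum>k=1..n. \<Sum>i. emeasure (return borel (X (int k) \<omega>)) (B i))"
      by (rule suminf_sum) auto
    also have "\<dots> = (\<Sum>k=1..n. emeasure (return borel (X (int k) \<omega>)) (\<Union>i. B i))"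
      using B by (intro sum.cong refl suminf_emeasure) auto
    finally show "(\<Sum>i. ?m (B i)) = ?m (\<Union>i. B i)" .
  qed
  moreover have "positive (sets borel) ?m"
    by (simp add: positive_def)
  ultimately have "emeasure (empirical_measure X n \<omega>) A = ?m A"
    using assms unfolding empirical_measure_def
    by (intro emeasure_measure_of_sigma)
      (auto simp: sets.sigma_algebra_axioms[of borel, simplified])
  then show ?thesis
    using assms by simp
qed

definition couplings :: "real measure \<Rightarrow> real measure \<Rightarrow> (real \<times> real) measure set" where
  "couplings \<mu>1 \<mu>2 =
     {\<pi>. prob_space \<pi> \<and> sets \<pi> = sets borel \<and>
         distr \<pi> borel fst = \<mu>1 \<and> distr \<pi> borel snd = \<mu>2}"

definition W1 :: "real measure \<Rightarrow> real measure \<Rightarrow> ennreal" where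
  "W1 \<mu>1 \<mu>2 = (INF \<pi>\<in>couplings \<mu>1 \<mu>2. \<integral>\<^sup>+ p. ennreal \<bar>fst p - snd p\<bar> \<partial>\<pi>)"

definition tail_fun :: "'a measure \<Rightarrow> ('a \<Rightarrow> real) \<Rightarrow> real \<Rightarrow> real" where
  "tail_fun M X0 t = measure M {\<omega> \<in> space M. t < \<bar>X0 \<omega>\<bar>}"

text \<open>In a probability space the supremum is over norms bounded by \<open>1\<close>, so it is a genuine
  supremum of reals.\<close>

definition alpha1 :: "'a measure \<Rightarrow> 'a measure \<Rightarrow> (int \<Rightarrow> 'a \<Rightarrow> real) \<Rightarrow> nat \<Rightarrow> real" where
  "alpha1 M F0 X n =
     (SUP x. \<integral>\<omega>. \<bar>real_cond_exp M F0 (indicator {\<omega> \<in> space M. X (int n) \<omega> \<le> x}) \<omega>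
                    - cdf (distr M borel (X 0)) x\<bar> \<partial>M)"

definition S_alpha :: "'a measure \<Rightarrow> 'a measure \<Rightarrow> (int \<Rightarrow> 'a \<Rightarrow> real) \<Rightarrow> nat \<Rightarrow> real \<Rightarrow> real" where
  "S_alpha M F0 X n t = (\<Sum>k=0..n. min (alpha1 M F0 X k) (tail_fun M (X 0) t))"

text \<open>The norm of \<open>L\<^sup>2\<close> of a function with values in \<open>[0, \<infinity>]\<close>, possibly infinite.\<close>

definition ennreal_sqrt :: "ennreal \<Rightarrow> ennreal" where
  "ennreal_sqrt x = (if x = \<infinity> then \<infinity> else ennreal (sqrt (enn2real x)))"

definition L2_norm_nn :: "'a measure \<Rightarrow> ('a \<Rightarrow> ennreal) \<Rightarrow> ennreal" where
  "L2_norm_nn M f = ennreal_sqrt (\<integral>\<^sup>+ \<omega>. (f \<omega>)\<^sup>2 \<partial>M)"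

end

theory Submission
  imports Defs
begin

text \<open>
  The quantile coupling gives \<open>W1 \<mu>\<^sub>n \<mu> \<le> \<integral> \<bar>F\<^sub>n t - F t\<bar> dt\<close>. With \<open>v = F t * (1 - F t)\<close>, one has
  \<open>E \<bar>F\<^sub>n t - F t\<bar> \<le> 2 * v\<close>. The covariance of \<open>1{X\<^sub>i \<le> t}\<close> and \<open>1{X\<^sub>j \<le> t}\<close> is at most \<open>v\<close> by
  Cauchy-Schwarz, and at most \<open>\<alpha>(j - i)\<close> by stationarity and conditioning on \<open>F0\<close>, so
  \<open>E (F\<^sub>n t - F t)\<^sup>2 \<le> (2 / n) * (\<Sum>k\<le>n. min (\<alpha> k) v)\<close>. Away from the countably many atoms of \<open>\<mu>\<close>,
  \<open>v \<le> H \<bar>t\<bar>\<close>; it remains to integrate over \<open>t\<close>, using Minkowski's integral inequality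
  for the norm of \<open>L\<^sup>2\<close>.
\<close>

section \<open>Wasserstein distance and distribution functions\<close>

lemma nn_integral_abs_diff_of_bool:
  fixes a b :: real
  shows "(\<integral>\<^sup>+ x. ennreal \<bar>of_bool (a \<le> x) - of_bool (b \<le> x)\<bar> \<partial>lborel) = ennreal \<bar>a - b\<bar>"
proof -
  have *: "(\<integral>\<^sup>+ x. ennreal \<bar>of_bool (c \<le> x) - of_bool (d \<le> x)\<bar> \<partial>lborel) = ennreal \<bar>c - d\<bar>"
    if "c \<le> d" for c d :: real
  proof -
    have "(\<integral>\<^sup>+ x. ennreal \<bar>of_bool (c \<le> x) - of_bool (d \<le> x)\<bar> \<partial>lborel)
        = (\<integral>\<^sup>+ x. indicator {c..<d} x \<partial>lborel)"
      using that by (intro nn_integral_cong) (auto simp: indicator_def)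
    then show ?thesis
      using that by simp
  qed
  show ?thesis
    using *[of a b] *[of b a] by (cases "a \<le> b") (simp_all add: abs_minus_commute)
qed

text \<open>The coupling pushes one uniform variable \<open>u\<close> through both quantile
  functions. Its cost is written as an integral over thresholds \<open>x\<close>; after exchanging
  the integrals, it remains to measure, for fixed \<open>x\<close>, the set of \<open>u\<close>
  whose two quantiles lie on opposite sides of \<open>x\<close>.\<close>

lemma W1_le_nn_integral_cdf:
  assumes "real_distribution P" "real_distribution Q"
  shows "W1 P Q \<le> (\<integral>\<^sup>+ x. ennreal \<bar>cdf P x - cdf Q x\<bar> \<partial>lborel)"
proof -
  interpret P: cdf_distribution P
    using assms(1) by (simp add: cdf_distribution_def)
  interpret Q: cdf_distribution Q
    using assms(2) by (simp add: cdf_distribution_def)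
  \<comment> \<open>The interval is open because a quantile function may be infinite at 0 and
    1.\<close>
  define U where "U = (restrict_space lborel {0<..<1} :: real measure)"
  have space_U [simp]: "space U = {0<..<1}"
    by (simp add: U_def space_restrict_space)
  have [measurable_cong]: "sets U = sets (restrict_space borel {0<..<1})"
    by (simp add: U_def sets_restrict_space)
  interpret U: prob_space U
    by (auto simp: U_def emeasure_restrict_space space_restrict_space intro!: prob_spaceI)
  interpret UL: pair_sigma_finite U lborel ..
  have [measurable]: "P.I \<in> borel_measurable U" "Q.I \<in> borel_measurable U"
    by measurable
  define \<pi> where "\<pi> = distr U borel (\<lambda>u. (P.I u, Q.I u))"
  have "distr \<pi> borel fst = P" "distr \<pi> borel snd = Q"
    using P.distr_I_eq_M Q.distr_I_eq_M
    by (simp_all add: \<pi>_def distr_distr borel_prod[symmetric] comp_def U_def [symmetric])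
  then have "\<pi> \<in> couplings P Q"
    by (auto simp: couplings_def \<pi>_def intro!: U.prob_space_distr)
  then have "W1 P Q \<le> (\<integral>\<^sup>+ p. ennreal \<bar>fst p - snd p\<bar> \<partial>\<pi>)"
    unfolding W1_def by (rule INF_lower)
  also have "\<dots> = (\<integral>\<^sup>+ u. ennreal \<bar>P.I u - Q.I u\<bar> \<partial>U)"
    unfolding \<pi>_def by (subst nn_integral_distr) (auto simp: borel_prod[symmetric])
  also have "\<dots> = (\<integral>\<^sup>+ u. \<integral>\<^sup>+ x. ennreal \<bar>of_bool (P.I u \<le> x) - of_bool (Q.I u \<le> x)\<bar> \<partial>lborel \<partial>U)"
    by (simp add: nn_integral_abs_diff_of_bool)
  also have "\<dots> = (\<integral>\<^sup>+ x. \<integral>\<^sup>+ u. ennreal \<bar>of_bool (P.I u \<le> x) - of_bool (Q.I u \<le> x)\<bar> \<partial>U \<partial>lborel)"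
    by (rule UL.Fubini'[symmetric]) measurable
  also have "\<dots> \<le> (\<integral>\<^sup>+ x. ennreal \<bar>cdf P x - cdf Q x\<bar> \<partial>lborel)"
  proof (rule nn_integral_mono)
    fix x :: real
    \<comment> \<open>The quantile at \<open>u\<close> is at most \<open>x\<close> exactly when
      \<open>u\<close> is at most the distribution function at \<open>x\<close>. So the two
      indicators differ only when \<open>u\<close> lies between the two values of the distribution
      functions, an interval whose length is the desired bound.\<close>
    let ?S = "{min (P.C x) (Q.C x)<..max (P.C x) (Q.C x)}"
    have "(\<integral>\<^sup>+ u. ennreal \<bar>of_bool (P.I u \<le> x) - of_bool (Q.I u \<le> x)\<bar> \<partial>U)
        \<le> (\<integral>\<^sup>+ u. indicator ?S u \<partial>U)"
    proof (rule nn_integral_mono)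
      fix u assume "u \<in> space U"
      then have "P.I u \<le> x \<longleftrightarrow> u \<le> P.C x" "Q.I u \<le> x \<longleftrightarrow> u \<le> Q.C x"
        using P.pseudoinverse[of u x] Q.pseudoinverse[of u x] by simp_all
      then show "ennreal \<bar>of_bool (P.I u \<le> x) - of_bool (Q.I u \<le> x)\<bar> \<le> indicator ?S u"
        by (simp only:) (auto simp: indicator_def of_bool_def)
    qed
    also have "\<dots> = (\<integral>\<^sup>+ u. indicator ?S u * indicator {0<..<1} u \<partial>lborel)"
      unfolding U_def by (subst nn_integral_restrict_space) simp_all
    also have "\<dots> \<le> (\<integral>\<^sup>+ u. indicator ?S u \<partial>lborel)"
      by (intro nn_integral_mono) (simp add: indicator_def)
    also have "\<dots> = ennreal \<bar>P.C x - Q.C x\<bar>"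
      by (auto simp: min_def max_def)
    finally show "(\<integral>\<^sup>+ u. ennreal \<bar>of_bool (P.I u \<le> x) - of_bool (Q.I u \<le> x)\<bar> \<partial>U)
        \<le> ennreal \<bar>P.C x - Q.C x\<bar>" .
  qed
  finally show ?thesis .
qed

section \<open>Minkowski's integral inequality for square integrals\<close>

lemma ennreal_power2_le_imp_le:
  fixes x y :: ennreal
  assumes "x\<^sup>2 \<le> y\<^sup>2"
  shows "x \<le> y"
proof (cases x)
  case x: (real r)
  show ?thesis
  proof (cases y)
    case (real s)
    then have "r\<^sup>2 \<le> s\<^sup>2"
      using assms x by (simp add: ennreal_power)
    then show ?thesis
      using real x by (auto intro: power2_le_imp_le)
  qed simp
next
  case top
  then have "y\<^sup>2 = top"
    using assms by (simp add: power2_eq_square top_unique)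
  then show ?thesis
    by (cases y) (simp_all add: ennreal_power)
qed

text \<open>The square of the inner integral is a double integral over pairs \<open>(t, s)\<close>.
  After moving the integral over \<open>x\<close> inside, Cauchy-Schwarz bounds each pair by
  \<open>b t * b s\<close>, and the product factorises again. Squares on both sides avoid roots of
  extended reals; the hypothesis is almost everywhere in \<open>t\<close> because the later bound
  fails to be available at atoms.\<close>

lemma nn_integral_square_nn_integral_le:
  fixes f :: "'a \<Rightarrow> 'b \<Rightarrow> ennreal"
  assumes "sigma_finite_measure M" "sigma_finite_measure N"
    and f [measurable]: "case_prod f \<in> borel_measurable (M \<Otimes>\<^sub>M N)"
    and [measurable]: "b \<in> borel_measurable N"
    and b: "AE t in N. (\<integral>\<^sup>+ x. (f x t)\<^sup>2 \<partial>M) \<le> (b t)\<^sup>2"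
  shows "(\<integral>\<^sup>+ x. (\<integral>\<^sup>+ t. f x t \<partial>N)\<^sup>2 \<partial>M) \<le> (\<integral>\<^sup>+ t. b t \<partial>N)\<^sup>2"
proof -
  interpret M: sigma_finite_measure M by fact
  interpret N: sigma_finite_measure N by fact
  interpret MN: pair_sigma_finite M N ..
  have le: "(\<integral>\<^sup>+ x. f x t * f x s \<partial>M) \<le> b t * b s"
    if "(\<integral>\<^sup>+ x. (f x t)\<^sup>2 \<partial>M) \<le> (b t)\<^sup>2" "(\<integral>\<^sup>+ x. (f x s)\<^sup>2 \<partial>M) \<le> (b s)\<^sup>2"
      "t \<in> space N" "s \<in> space N" for t s
  proof (rule ennreal_power2_le_imp_le)
    have "(\<integral>\<^sup>+ x. f x t * f x s \<partial>M)\<^sup>2 \<le> (\<integral>\<^sup>+ x. (f x t)\<^sup>2 \<partial>M) * (\<integral>\<^sup>+ x. (f x s)\<^sup>2 \<partial>M)"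
      using that(3,4) by (intro Cauchy_Schwarz_nn_integral) measurable
    also have "\<dots> \<le> (b t)\<^sup>2 * (b s)\<^sup>2"
      by (intro mult_mono that) auto
    finally show "(\<integral>\<^sup>+ x. f x t * f x s \<partial>M)\<^sup>2 \<le> (b t * b s)\<^sup>2"
      by (simp add: power_mult_distrib)
  qed
  have "(\<integral>\<^sup>+ x. (\<integral>\<^sup>+ t. f x t \<partial>N)\<^sup>2 \<partial>M) = (\<integral>\<^sup>+ x. \<integral>\<^sup>+ t. \<integral>\<^sup>+ s. f x t * f x s \<partial>N \<partial>N \<partial>M)"
    by (intro nn_integral_cong) (simp add: nn_integral_cmult nn_integral_multc power2_eq_square)
  also have "\<dots> = (\<integral>\<^sup>+ t. \<integral>\<^sup>+ x. \<integral>\<^sup>+ s. f x t * f x s \<partial>N \<partial>M \<partial>N)"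
    by (rule MN.Fubini'[symmetric]) measurable
  also have "\<dots> = (\<integral>\<^sup>+ t. \<integral>\<^sup>+ s. \<integral>\<^sup>+ x. f x t * f x s \<partial>M \<partial>N \<partial>N)"
    by (intro nn_integral_cong MN.Fubini'[symmetric]) measurable
  also have "\<dots> \<le> (\<integral>\<^sup>+ t. \<integral>\<^sup>+ s. b t * b s \<partial>N \<partial>N)"
  proof (rule nn_integral_mono_AE)
    show "AE t in N. (\<integral>\<^sup>+ s. \<integral>\<^sup>+ x. f x t * f x s \<partial>M \<partial>N) \<le> (\<integral>\<^sup>+ s. b t * b s \<partial>N)"
      using b AE_space
    proof eventually_elim
      case (elim t)
      then show ?case
        \<comment> \<open>The bound is used a second time here, now for almost every
          \<open>s\<close> with \<open>t\<close> fixed.\<close>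
        using b AE_space by (intro nn_integral_mono_AE) (auto intro: le elim!: eventually_rev_mp)
    qed
  qed
  also have "\<dots> = (\<integral>\<^sup>+ t. b t \<partial>N)\<^sup>2"
    by (simp add: nn_integral_cmult nn_integral_multc power2_eq_square)
  finally show ?thesis .
qed

section \<open>Moment and covariance inequalities\<close>

context prob_space
begin

text \<open>Each row of the covariance matrix is split at the diagonal. On either side the lag
  determines \<open>j\<close> and lies in \<open>{0..n}\<close>, so by nonnegativity of
  \<open>m\<close> each side is at most the full sum of \<open>m\<close>. Two sides and
  \<open>n\<close> rows give the factor \<open>2 * n\<close>.\<close>

lemma expectation_square_sum_le:
  fixes Z :: "nat \<Rightarrow> 'a \<Rightarrow> real" and m :: "nat \<Rightarrow> real"
  assumes int: "\<And>i j. integrable M (\<lambda>\<omega>. Z i \<omega> * Z j \<omega>)"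
    and cov: "\<And>i j. i \<le> j \<Longrightarrow> j \<le> n \<Longrightarrow> expectation (\<lambda>\<omega>. Z i \<omega> * Z j \<omega>) \<le> m (j - i)"
    and m: "\<And>k. k \<le> n \<Longrightarrow> 0 \<le> m k"
  shows "expectation (\<lambda>\<omega>. (\<Sum>k=1..n. Z k \<omega>)\<^sup>2) \<le> 2 * real n * (\<Sum>k=0..n. m k)"
proof -
  have row: "(\<Sum>j=1..n. expectation (\<lambda>\<omega>. Z i \<omega> * Z j \<omega>)) \<le> 2 * (\<Sum>k=0..n. m k)"
    if i: "i \<in> {1..n}" for i
  proof -
    have "(\<Sum>j=1..n. expectation (\<lambda>\<omega>. Z i \<omega> * Z j \<omega>))
        = (\<Sum>j\<in>{1..i} \<union> {i<..n}. expectation (\<lambda>\<omega>. Z i \<omega> * Z j \<omega>))"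
      using i by (intro sum.cong) auto
    also have "\<dots> = (\<Sum>j=1..i. expectation (\<lambda>\<omega>. Z j \<omega> * Z i \<omega>))
        + (\<Sum>j\<in>{i<..n}. expectation (\<lambda>\<omega>. Z i \<omega> * Z j \<omega>))"
      by (subst sum.union_disjoint) (auto simp: mult.commute)
    also have "\<dots> \<le> (\<Sum>j=1..i. m (i - j)) + (\<Sum>j\<in>{i<..n}. m (j - i))"
      using i by (intro add_mono sum_mono cov) auto
    also have "(\<Sum>j=1..i. m (i - j)) = (\<Sum>k\<in>(\<lambda>j. i - j) ` {1..i}. m k)"
      by (subst sum.reindex) (auto simp: inj_on_def)
    also have "\<dots> \<le> (\<Sum>k=0..n. m k)"
      using i by (intro sum_mono2) (auto simp: m)
    also have "(\<Sum>j\<in>{i<..n}. m (j - i)) = (\<Sum>k\<in>(\<lambda>j. j - i) ` {i<..n}. m k)"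
      by (subst sum.reindex) (auto simp: inj_on_def)
    also have "\<dots> \<le> (\<Sum>k=0..n. m k)"
      using i by (intro sum_mono2) (auto simp: m)
    finally show ?thesis
      by simp
  qed
  have "expectation (\<lambda>\<omega>. (\<Sum>k=1..n. Z k \<omega>)\<^sup>2)
      = (\<Sum>i=1..n. \<Sum>j=1..n. expectation (\<lambda>\<omega>. Z i \<omega> * Z j \<omega>))"
    by (simp add: power2_eq_square sum_product int)
  also have "\<dots> \<le> (\<Sum>i=1..n. 2 * (\<Sum>k=0..n. m k))"
    by (intro sum_mono row)
  finally show ?thesis
    by simp
qed

text \<open>Since \<open>f\<close> is measurable for the smaller sigma-algebra, \<open>g\<close> can
  be replaced under the expectation by its conditional expectation; the bound on \<open>f\<close>
  then removes it. This is how the mixing coefficient comes to control a covariance.\<close>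

lemma abs_expectation_mult_le_cond_exp:
  fixes f g :: "'a \<Rightarrow> real"
  assumes "subalgebra M F" and f: "f \<in> borel_measurable F" "\<And>\<omega>. \<bar>f \<omega>\<bar> \<le> 1"
    and g: "integrable M g"
  shows "\<bar>expectation (\<lambda>\<omega>. f \<omega> * (g \<omega> - c))\<bar>
    \<le> expectation (\<lambda>\<omega>. \<bar>real_cond_exp M F g \<omega> - c\<bar>)"
proof -
  interpret finite_measure_subalgebra M F
    by standard fact
  have [measurable]: "f \<in> borel_measurable M"
    using f(1) assms(1) by (rule measurable_from_subalg[rotated])
  have fi: "integrable M (\<lambda>\<omega>. f \<omega> * h \<omega>)" if "integrable M h" for h
    using that f(2)
    by (intro Bochner_Integration.integrable_bound[OF that]) (auto simp: abs_mult mult_left_le_one_le)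
  have "expectation (\<lambda>\<omega>. f \<omega> * (g \<omega> - c))
      = expectation (\<lambda>\<omega>. f \<omega> * g \<omega>) - expectation (\<lambda>\<omega>. f \<omega> * c)"
    using fi[OF g] fi[of "\<lambda>_. c"] by (simp add: right_diff_distrib)
  also have "expectation (\<lambda>\<omega>. f \<omega> * g \<omega>) = expectation (\<lambda>\<omega>. f \<omega> * real_cond_exp M F g \<omega>)"
    using g f(1) by (intro real_cond_exp_intg(2)[symmetric] fi) auto
  also have "\<dots> - expectation (\<lambda>\<omega>. f \<omega> * c)
      = expectation (\<lambda>\<omega>. f \<omega> * (real_cond_exp M F g \<omega> - c))"
    using fi[OF real_cond_exp_int(1)[OF g]] fi[of "\<lambda>_. c"] by (simp add: right_diff_distrib)
  also have "\<bar>\<dots>\<bar> \<le> expectation (\<lambda>\<omega>. \<bar>real_cond_exp M F g \<omega> - c\<bar>)"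
    using f(2) g
    by (intro order_trans[OF integral_abs_bound] integral_mono integrable_abs fi
        Bochner_Integration.integrable_diff real_cond_exp_int(1))
      (auto simp: abs_mult mult_left_le_one_le)
  finally show ?thesis .
qed

text \<open>A function of a variable with values in {0, 1} is affine in it. The coefficients below
  are found by matching the values at 0 and 1, and \<open>lin\<close> evaluates the
  expectation.\<close>

lemma expectation_centred_indicator:
  assumes [measurable]: "A \<in> events"
  shows "expectation (\<lambda>\<omega>. (indicator A \<omega> - prob A)\<^sup>2) = prob A * (1 - prob A)"
    and "expectation (\<lambda>\<omega>. \<bar>indicator A \<omega> - prob A\<bar>) = 2 * (prob A * (1 - prob A))"
proof -
  let ?p = "prob A"
  have "integrable M (indicator A :: 'a \<Rightarrow> real)"
    by (intro integrable_real_indicator) (auto simp: less_top[symmetric])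
  then have lin: "expectation (\<lambda>\<omega>. indicator A \<omega> * a + b) = ?p * a + b" for a b :: real
    by (subst Bochner_Integration.integral_add) (auto simp: prob_space)
  have "expectation (\<lambda>\<omega>. (indicator A \<omega> - ?p)\<^sup>2)
      = expectation (\<lambda>\<omega>. indicator A \<omega> * (1 - 2 * ?p) + ?p\<^sup>2)"
    by (intro Bochner_Integration.integral_cong) (auto simp: indicator_def power2_eq_square algebra_simps)
  then show "expectation (\<lambda>\<omega>. (indicator A \<omega> - ?p)\<^sup>2) = ?p * (1 - ?p)"
    by (simp only: lin) (simp add: power2_eq_square algebra_simps)
  have "expectation (\<lambda>\<omega>. \<bar>indicator A \<omega> - ?p\<bar>)
      = expectation (\<lambda>\<omega>. indicator A \<omega> * (1 - 2 * ?p) + ?p)"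
    by (intro Bochner_Integration.integral_cong) (auto simp: indicator_def)
  then show "expectation (\<lambda>\<omega>. \<bar>indicator A \<omega> - ?p\<bar>) = 2 * (?p * (1 - ?p))"
    by (simp only: lin) (simp add: algebra_simps)
qed

end

section \<open>Variance of an indicator against the tail, and folding the line\<close>

lemma (in prob_space) AE_cdf_variance_le_tail:
  assumes [measurable]: "Y \<in> borel_measurable M"
  defines "F \<equiv> cdf (distr M borel Y)"
  shows "AE t in lborel. F t * (1 - F t) \<le> tail_fun M Y \<bar>t\<bar>"
proof -
  interpret D: real_distribution "distr M borel Y"
    by simp
  have F: "F t = prob {\<omega>\<in>space M. Y \<omega> \<le> t}" for t
    by (auto simp: F_def cdf_def measure_distr intro!: arg_cong[where f = prob])
  \<comment> \<open>For negative \<open>t\<close>, the left part of the tail event is the strict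
    one, \<open>Y < t\<close>, while \<open>F t\<close> also counts an atom at \<open>t\<close>. The
    atoms are countable, hence Lebesgue null.\<close>
  have "{t. 0 < measure (distr M borel Y) {t}} \<in> null_sets lborel"
    using D.countable_atoms by (rule countable_imp_null_set_lborel)
  then have "AE t in lborel. measure (distr M borel Y) {t} = 0"
    by (rule AE_I') (simp add: zero_less_measure_iff)
  then show ?thesis
  proof eventually_elim
    case (elim t)
    have 01: "0 \<le> F t" "F t \<le> 1"
      by (simp_all add: F)
    show ?case
    \<comment> \<open>For \<open>t\<close> nonnegative the factor \<open>1 - F t\<close> is kept,
      for \<open>t\<close> negative the factor \<open>F t\<close>: the one that measures a tail. The
      other is at most 1.\<close>
    proof (cases "0 \<le> t")
      case True
      have "F t * (1 - F t) \<le> 1 - F t"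
        using 01 by (intro mult_left_le_one_le) auto
      also have "\<dots> = prob {\<omega>\<in>space M. \<not> Y \<omega> \<le> t}"
        unfolding F by (subst prob_neg) auto
      also have "\<dots> \<le> tail_fun M Y \<bar>t\<bar>"
        unfolding tail_fun_def using True by (intro finite_measure_mono) auto
      finally show ?thesis .
    next
      case False
      have "F t * (1 - F t) \<le> F t"
        using 01 by (intro mult_right_le_one_le) auto
      also have "\<dots> \<le> prob ({\<omega>\<in>space M. Y \<omega> < t} \<union> {\<omega>\<in>space M. Y \<omega> = t})"
        unfolding F by (intro finite_measure_mono) auto
      also have "\<dots> \<le> prob {\<omega>\<in>space M. Y \<omega> < t} + prob {\<omega>\<in>space M. Y \<omega> = t}"
        by (rule measure_Un_le) auto
      also have "prob {\<omega>\<in>space M. Y \<omega> = t} = measure (distr M borel Y) {t}"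
        by (auto simp: measure_distr intro!: arg_cong[where f = prob])
      also have "prob {\<omega>\<in>space M. Y \<omega> < t} + measure (distr M borel Y) {t} \<le> tail_fun M Y \<bar>t\<bar>"
        unfolding tail_fun_def elim using False by (auto intro!: finite_measure_mono)
      finally show ?thesis .
    qed
  qed
qed

lemma (in prob_space) tail_fun_measurable [measurable]:
  assumes [measurable]: "Y \<in> borel_measurable M"
  shows "tail_fun M Y \<in> borel_measurable borel"
proof -
  have "mono (\<lambda>t. - tail_fun M Y t)"
    unfolding tail_fun_def by (auto intro!: monoI finite_measure_mono)
  then have "(\<lambda>t. - (- tail_fun M Y t)) \<in> borel_measurable borel"
    by (intro borel_measurable_uminus borel_measurable_mono)
  then show ?thesis
    by simp
qed

text \<open>The pointwise bounds depend on the absolute value of \<open>t\<close>, whereas the final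
  integrals run over the half line. This folding contributes a factor 2 to both constants.\<close>

lemma nn_integral_even:
  fixes f :: "real \<Rightarrow> ennreal"
  assumes [measurable]: "f \<in> borel_measurable borel"
  shows "(\<integral>\<^sup>+ t. f \<bar>t\<bar> \<partial>lborel) = 2 * (\<integral>\<^sup>+ t\<in>{0..}. f t \<partial>lborel)"
proof -
  have "(\<integral>\<^sup>+ t. f \<bar>t\<bar> \<partial>lborel)
      = (\<integral>\<^sup>+ t. f \<bar>t\<bar> * indicator {0..} t + f \<bar>t\<bar> * indicator {..<0} t \<partial>lborel)"
    by (intro nn_integral_cong) (auto simp: indicator_def)
  also have "\<dots> = (\<integral>\<^sup>+ t. f \<bar>t\<bar> * indicator {0..} t \<partial>lborel)
      + (\<integral>\<^sup>+ t. f \<bar>t\<bar> * indicator {..<0} t \<partial>lborel)"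
    by (rule nn_integral_add) measurable
  \<comment> \<open>Reflection at the origin; the single point 0 is then added back as a null
    set.\<close>
  also have "(\<integral>\<^sup>+ t. f \<bar>t\<bar> * indicator {..<0} t \<partial>lborel)
      = (\<integral>\<^sup>+ t. f \<bar>t\<bar> * indicator {0<..} t \<partial>lborel)"
    by (subst nn_integral_real_affine[of _ "-1" 0]) (auto simp: indicator_def intro!: nn_integral_cong)
  also have "\<dots> = (\<integral>\<^sup>+ t. f \<bar>t\<bar> * indicator {0..} t \<partial>lborel)"
    using AE_lborel_singleton[of 0]
    by (intro nn_integral_cong_AE) (auto simp: indicator_def elim!: eventually_mono)
  also have "(\<integral>\<^sup>+ t. f \<bar>t\<bar> * indicator {0..} t \<partial>lborel) = (\<integral>\<^sup>+ t\<in>{0..}. f t \<partial>lborel)"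
    by (intro nn_integral_cong) (auto simp: indicator_def)
  finally show ?thesis
    by (simp add: mult_2)
qed

section \<open>Extended square roots and the empirical distribution function\<close>

lemma ennreal_sqrt_mono: "x \<le> y \<Longrightarrow> ennreal_sqrt x \<le> ennreal_sqrt y"
  by (auto simp: ennreal_sqrt_def top_unique less_top intro!: ennreal_leI real_sqrt_le_mono enn2real_mono)

lemma ennreal_sqrt_power2 [simp]: "ennreal_sqrt (x\<^sup>2) = x"
  by (cases x) (simp_all add: ennreal_sqrt_def ennreal_power power2_eq_square ennreal_mult[symmetric])

lemma real_distribution_empirical_measure:
  assumes "n \<ge> 1"
  shows "real_distribution (empirical_measure X n \<omega>)"
proof -
  have "emeasure (empirical_measure X n \<omega>) UNIV = 1"
    using assms by (simp add: emeasure_empirical_measure ennreal_of_nat_eq_real_of_nat ennreal_mult[symmetric])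
  then show ?thesis
    by (auto simp: real_distribution_def real_distribution_axioms_def intro!: prob_spaceI)
qed

lemma cdf_empirical_measure:
  "cdf (empirical_measure X n \<omega>) t = (\<Sum>k=1..n. of_bool (X (int k) \<omega> \<le> t)) / real n"
proof -
  have "(\<Sum>k=1..n. indicator {..t} (X (int k) \<omega>) :: ennreal)
      = ennreal (\<Sum>k=1..n. of_bool (X (int k) \<omega> \<le> t))"
    by (subst sum_ennreal[symmetric]) (auto simp: indicator_def ennreal_of_nat_eq_real_of_nat)
  then show ?thesis
    by (simp add: cdf_def measure_def emeasure_empirical_measure ennreal_mult[symmetric] sum_nonneg)
qed

section \<open>The stationary sequence and its centred indicators\<close>

locale stationary_orbit = prob_space M for M :: "'a measure" +
  fixes F0 :: "'a measure" and T :: "'a \<Rightarrow> 'a" and X0 :: "'a \<Rightarrow> real" and X :: "int \<Rightarrow> 'a \<Rightarrow> real"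
  assumes subalg: "subalgebra M F0"
    and X0_F0: "X0 \<in> borel_measurable F0"
    and T [measurable]: "T \<in> measurable M M"
    and T_preserving: "distr M M T = M"
    and X_nat: "\<And>k. X (int k) = X0 \<circ> T ^^ k"
begin

lemma T_funpow [measurable]: "T ^^ k \<in> measurable M M"
  by (induction k) (auto intro: measurable_comp)

lemma T_funpow_preserving: "distr M M (T ^^ k) = M"
proof (induction k)
  case 0
  show ?case
    by (simp add: distr_id2 id_def)
next
  case (Suc k)
  have "distr M M (T ^^ Suc k) = distr (distr M M (T ^^ k)) M T"
    by (subst distr_distr) auto
  with Suc show ?case
    by (simp add: T_preserving comp_def)
qed

lemma X0_measurable [measurable]: "X0 \<in> borel_measurable M"
  by (rule measurable_from_subalg[OF subalg X0_F0])

lemma X_measurable [measurable]: "X (int k) \<in> borel_measurable M"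
  unfolding X_nat by (rule measurable_comp[OF T_funpow X0_measurable])

lemma X_0: "X 0 = X0"
  using X_nat[of 0] by simp

lemma X_shift: "X (int (i + k)) \<omega> = X (int k) ((T ^^ i) \<omega>)"
  by (simp only: X_nat comp_apply add.commute[of i k] funpow_add)

text \<open>Together with \<open>Z_shift\<close>, this is the form in which stationarity is applied
  to the centred indicators and their products.\<close>

lemma expectation_T_funpow:
  fixes f :: "'a \<Rightarrow> real"
  assumes "f \<in> borel_measurable M"
  shows "expectation (\<lambda>\<omega>. f ((T ^^ k) \<omega>)) = expectation f"
  using integral_distr[OF T_funpow assms, of k] by (simp add: T_funpow_preserving)

definition F :: "real \<Rightarrow> real" where
  "F = cdf (distr M borel X0)"

definition Z :: "real \<Rightarrow> nat \<Rightarrow> 'a \<Rightarrow> real" where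
  "Z t k \<omega> = of_bool (X (int k) \<omega> \<le> t) - F t"

lemma F_measurable [measurable]: "F \<in> borel_measurable borel"
proof -
  interpret D: cdf_distribution "distr M borel X0"
    by (simp add: cdf_distribution_def)
  show ?thesis
    by (simp add: F_def)
qed

lemma F_eq: "F t = prob {\<omega>\<in>space M. X0 \<omega> \<le> t}"
  by (auto simp: F_def cdf_def measure_distr intro!: arg_cong[where f = prob])

lemma F_bounds: "0 \<le> F t" "F t \<le> 1"
  by (simp_all add: F_eq)

lemma Z_measurable [measurable]: "(\<lambda>(\<omega>, t). Z t k \<omega>) \<in> borel_measurable (M \<Otimes>\<^sub>M borel)"
  unfolding Z_def by measurable

lemma Z_measurable' [measurable]: "Z t k \<in> borel_measurable M"
  unfolding Z_def by measurable

lemma abs_Z_le: "\<bar>Z t k \<omega>\<bar> \<le> 1"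
  using F_bounds[of t] by (auto simp: Z_def)

lemma Z_shift: "Z t (i + k) \<omega> = Z t k ((T ^^ i) \<omega>)"
  by (simp only: Z_def X_shift)

lemma integrable_Z: "integrable M (Z t k)"
  by (rule integrable_const_bound[where B = 1]) (auto simp: abs_Z_le)

lemma integrable_Z_mult: "integrable M (\<lambda>\<omega>. Z t i \<omega> * Z t j \<omega>)"
  by (rule integrable_const_bound[where B = 1])
    (auto simp: abs_mult intro!: mult_le_one abs_Z_le)

lemma Z_0:
  "expectation (\<lambda>\<omega>. (Z t 0 \<omega>)\<^sup>2) = F t * (1 - F t)"
  "expectation (\<lambda>\<omega>. \<bar>Z t 0 \<omega>\<bar>) = 2 * (F t * (1 - F t))"
proof -
  let ?A = "{\<omega>\<in>space M. X0 \<omega> \<le> t}"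
  have Z: "Z t 0 \<omega> = indicator ?A \<omega> - prob ?A" if "\<omega> \<in> space M" for \<omega>
    using that by (simp add: Z_def X_0 F_eq)
  show "expectation (\<lambda>\<omega>. (Z t 0 \<omega>)\<^sup>2) = F t * (1 - F t)"
    using expectation_centred_indicator(1)[of ?A]
    by (simp add: Z F_eq cong: Bochner_Integration.integral_cong)
  show "expectation (\<lambda>\<omega>. \<bar>Z t 0 \<omega>\<bar>) = 2 * (F t * (1 - F t))"
    using expectation_centred_indicator(2)[of ?A]
    by (simp add: Z F_eq cong: Bochner_Integration.integral_cong)
qed

lemma Z_stationary:
  "expectation (\<lambda>\<omega>. (Z t k \<omega>)\<^sup>2) = F t * (1 - F t)"
  "expectation (\<lambda>\<omega>. \<bar>Z t k \<omega>\<bar>) = 2 * (F t * (1 - F t))"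
proof -
  have Z: "Z t k = (\<lambda>\<omega>. Z t 0 ((T ^^ k) \<omega>))"
    using Z_shift[of t k 0] by (simp add: fun_eq_iff)
  show "expectation (\<lambda>\<omega>. (Z t k \<omega>)\<^sup>2) = F t * (1 - F t)"
    unfolding Z by (subst expectation_T_funpow) (simp_all add: Z_0)
  show "expectation (\<lambda>\<omega>. \<bar>Z t k \<omega>\<bar>) = 2 * (F t * (1 - F t))"
    unfolding Z by (subst expectation_T_funpow) (simp_all add: Z_0)
qed

text \<open>A real supremum dominates its members only if they are bounded above. The bound 1 holds
  because the conditional probability, almost surely, and \<open>F x\<close> both lie in
  [0, 1].\<close>

lemma cond_exp_le_alpha1:
  "expectation (\<lambda>\<omega>. \<bar>real_cond_exp M F0 (indicator {\<omega>\<in>space M. X (int k) \<omega> \<le> t}) \<omega> - F t\<bar>)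
    \<le> alpha1 M F0 X k"
  (is "?e t \<le> _")
proof -
  interpret finite_measure_subalgebra M F0
    by standard (rule subalg)
  have "?e x \<le> 1" for x
  proof -
    let ?A = "{\<omega>\<in>space M. X (int k) \<omega> \<le> x}"
    have int: "integrable M (indicator ?A :: 'a \<Rightarrow> real)"
      by (intro integrable_real_indicator) (auto simp: less_top[symmetric])
    have "AE \<omega> in M. 0 \<le> real_cond_exp M F0 (indicator ?A) \<omega>"
      "AE \<omega> in M. real_cond_exp M F0 (indicator ?A) \<omega> \<le> 1"
      using int by (auto intro!: real_cond_exp_ge_c real_cond_exp_le_c simp: indicator_def)
    then have "AE \<omega> in M. \<bar>real_cond_exp M F0 (indicator ?A) \<omega> - F x\<bar> \<le> 1"
      by eventually_elim (use F_bounds[of x] in auto)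
    then have "?e x \<le> expectation (\<lambda>_. 1)"
      using int by (intro integral_mono_AE integrable_abs Bochner_Integration.integrable_diff
          real_cond_exp_int(1)) auto
    then show ?thesis
      by (simp add: prob_space)
  qed
  then have "?e t \<le> (SUP x. ?e x)"
    by (intro cSUP_upper bdd_aboveI[of _ 1]) auto
  then show ?thesis
    by (simp add: alpha1_def X_0 F_def)
qed

lemma alpha1_nonneg: "0 \<le> alpha1 M F0 X k"
  by (rule order_trans[OF _ cond_exp_le_alpha1[of k 0]]) simp

lemma covariance_le:
  assumes "i \<le> j"
  shows "expectation (\<lambda>\<omega>. Z t i \<omega> * Z t j \<omega>) \<le> min (alpha1 M F0 X (j - i)) (F t * (1 - F t))"
proof (rule min.boundedI)
  define k where "k = j - i"
  let ?A = "{\<omega>\<in>space M. X (int k) \<omega> \<le> t}"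
  \<comment> \<open>Shifting time by \<open>i\<close> makes the earlier factor \<open>Z t 0\<close>,
    which is measurable for \<open>F0\<close>, so that conditioning becomes possible.\<close>
  have "expectation (\<lambda>\<omega>. Z t i \<omega> * Z t j \<omega>) = expectation (\<lambda>\<omega>. Z t 0 \<omega> * Z t k \<omega>)"
  proof -
    have "Z t i \<omega> * Z t j \<omega> = Z t 0 ((T ^^ i) \<omega>) * Z t k ((T ^^ i) \<omega>)" for \<omega>
      using assms Z_shift[of t i 0 \<omega>] Z_shift[of t i k \<omega>] by (simp add: k_def)
    then show ?thesis
      using expectation_T_funpow[of "\<lambda>\<omega>. Z t 0 \<omega> * Z t k \<omega>" i] by simp
  qed
  also have "\<dots> = expectation (\<lambda>\<omega>. Z t 0 \<omega> * (indicator ?A \<omega> - F t))"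
    by (intro Bochner_Integration.integral_cong) (auto simp: Z_def)
  also have "\<dots> \<le> expectation (\<lambda>\<omega>. \<bar>real_cond_exp M F0 (indicator ?A) \<omega> - F t\<bar>)"
  proof (rule order_trans[OF abs_ge_self abs_expectation_mult_le_cond_exp])
    show "Z t 0 \<in> borel_measurable F0"
      using X0_F0 by (simp add: Z_def[abs_def] X_0)
    show "integrable M (indicator ?A :: 'a \<Rightarrow> real)"
      by (intro integrable_real_indicator) (auto simp: less_top[symmetric])
  qed (simp_all add: subalg abs_Z_le)
  also have "\<dots> \<le> alpha1 M F0 X k"
    by (rule cond_exp_le_alpha1)
  finally show "expectation (\<lambda>\<omega>. Z t i \<omega> * Z t j \<omega>) \<le> alpha1 M F0 X (j - i)"
    by (simp add: k_def)
  \<comment> \<open>The Cauchy-Schwarz bound in its additive form: both squares have the same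
    expectation by stationarity, so their mean is exactly the common variance.\<close>
  have "expectation (\<lambda>\<omega>. Z t i \<omega> * Z t j \<omega>) \<le> expectation (\<lambda>\<omega>. ((Z t i \<omega>)\<^sup>2 + (Z t j \<omega>)\<^sup>2) / 2)"
  proof (intro integral_mono integrable_Z_mult)
    show "integrable M (\<lambda>\<omega>. ((Z t i \<omega>)\<^sup>2 + (Z t j \<omega>)\<^sup>2) / 2)"
      using integrable_Z_mult by (simp add: power2_eq_square)
    show "Z t i \<omega> * Z t j \<omega> \<le> ((Z t i \<omega>)\<^sup>2 + (Z t j \<omega>)\<^sup>2) / 2" for \<omega>
      using sum_squares_bound[of "Z t i \<omega>" "Z t j \<omega>"] by simp
  qed
  also have "\<dots> = F t * (1 - F t)"
    using integrable_Z_mult[of t i i] integrable_Z_mult[of t j j] Z_stationary(1)[of t i] Z_stationary(1)[of t j]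
    by (simp add: power2_eq_square)
  finally show "expectation (\<lambda>\<omega>. Z t i \<omega> * Z t j \<omega>) \<le> F t * (1 - F t)" .
qed

lemma second_moment_le:
  "expectation (\<lambda>\<omega>. (\<Sum>k=1..n. Z t k \<omega>)\<^sup>2)
    \<le> 2 * real n * (\<Sum>k=0..n. min (alpha1 M F0 X k) (F t * (1 - F t)))"
  using F_bounds[of t]
  by (intro expectation_square_sum_le integrable_Z_mult covariance_le) (auto simp: alpha1_nonneg)

text \<open>The triangle inequality alone suffices here, whatever the dependence between the
  variables. It yields the tail side of the minimum in the first bound.\<close>

lemma first_moment_le:
  "expectation (\<lambda>\<omega>. \<bar>\<Sum>k=1..n. Z t k \<omega>\<bar>) \<le> real n * (2 * (F t * (1 - F t)))"
proof -
  have "expectation (\<lambda>\<omega>. \<bar>\<Sum>k=1..n. Z t k \<omega>\<bar>) \<le> expectation (\<lambda>\<omega>. \<Sum>k=1..n. \<bar>Z t k \<omega>\<bar>)"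
    by (intro integral_mono integrable_abs Bochner_Integration.integrable_sum integrable_Z sum_abs)
  also have "\<dots> = (\<Sum>k=1..n. 2 * (F t * (1 - F t)))"
    by (subst Bochner_Integration.integral_sum) (simp_all add: integrable_Z Z_stationary)
  finally show ?thesis
    by simp
qed

section \<open>Deviation of the empirical distribution function at a threshold\<close>

definition D :: "nat \<Rightarrow> real \<Rightarrow> 'a \<Rightarrow> real" where
  "D n t \<omega> = (\<Sum>k=1..n. Z t k \<omega>) / real n"

lemma D_measurable [measurable]: "(\<lambda>(\<omega>, t). D n t \<omega>) \<in> borel_measurable (M \<Otimes>\<^sub>M borel)"
  unfolding D_def by measurable

lemma D_measurable' [measurable]: "D n t \<in> borel_measurable M"
  unfolding D_def by measurable

lemma abs_D_le: "\<bar>D n t \<omega>\<bar> \<le> 1"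
proof (cases "n = 0")
  case False
  have "\<bar>\<Sum>k=1..n. Z t k \<omega>\<bar> \<le> (\<Sum>k=1..n. 1)"
    by (intro order_trans[OF sum_abs] sum_mono abs_Z_le)
  with False show ?thesis
    by (simp add: D_def)
qed (simp add: D_def)

lemma cdf_empirical_measure_diff:
  assumes "n \<ge> 1"
  shows "cdf (empirical_measure X n \<omega>) t - cdf (distr M borel X0) t = D n t \<omega>"
  using assms unfolding cdf_empirical_measure F_def[symmetric] D_def Z_def
  by (simp add: sum_subtractf diff_divide_distrib)

lemma W1_empirical_measure_le:
  assumes "n \<ge> 1"
  shows "W1 (empirical_measure X n \<omega>) (distr M borel X0) \<le> (\<integral>\<^sup>+ t. ennreal \<bar>D n t \<omega>\<bar> \<partial>lborel)"
  using W1_le_nn_integral_cdf[OF real_distribution_empirical_measure[OF assms, of X \<omega>], of "distr M borel X0"]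
  by (simp add: cdf_empirical_measure_diff[OF assms])

lemma S_alpha_nonneg: "0 \<le> S_alpha M F0 X n t"
  by (auto simp: S_alpha_def alpha1_nonneg tail_fun_def intro!: sum_nonneg)

lemma S_alpha_measurable [measurable]: "S_alpha M F0 X n \<in> borel_measurable borel"
  unfolding S_alpha_def X_0 by measurable

text \<open>Dividing \<open>second_moment_le\<close> by the square of \<open>n\<close> leaves the
  factor \<open>2 / n\<close>. Replacing the variance by the tail inside each minimum is what
  introduces the exceptional null set.\<close>

lemma AE_expectation_D_square_le:
  assumes "n \<ge> 1"
  shows "AE t in lborel. expectation (\<lambda>\<omega>. (D n t \<omega>)\<^sup>2) \<le> 2 * S_alpha M F0 X n \<bar>t\<bar> / real n"
  using AE_cdf_variance_le_tail[OF X0_measurable, folded F_def]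
proof eventually_elim
  case (elim t)
  have "expectation (\<lambda>\<omega>. (D n t \<omega>)\<^sup>2) = expectation (\<lambda>\<omega>. (\<Sum>k=1..n. Z t k \<omega>)\<^sup>2) / (real n)\<^sup>2"
    by (simp add: D_def power_divide)
  also have "\<dots> \<le> 2 * real n * (\<Sum>k=0..n. min (alpha1 M F0 X k) (F t * (1 - F t))) / (real n)\<^sup>2"
    by (intro divide_right_mono second_moment_le) simp
  also have "\<dots> \<le> 2 * real n * S_alpha M F0 X n \<bar>t\<bar> / (real n)\<^sup>2"
    unfolding S_alpha_def X_0 using elim
    by (intro divide_right_mono mult_left_mono sum_mono) auto
  finally show ?case
    using assms by (simp add: power2_eq_square)
qed

text \<open>The first moment gives twice the tail, the second moment gives twice the root of
  \<open>S / n\<close>; with the same factor in front, the two combine into one minimum under the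
  root.\<close>

lemma AE_expectation_abs_D_le:
  assumes "n \<ge> 1"
  shows "AE t in lborel. expectation (\<lambda>\<omega>. \<bar>D n t \<omega>\<bar>)
    \<le> 2 * sqrt (min ((tail_fun M X0 \<bar>t\<bar>)\<^sup>2) (S_alpha M F0 X n \<bar>t\<bar> / real n))"
  using AE_cdf_variance_le_tail[OF X0_measurable, folded F_def] AE_expectation_D_square_le[OF assms]
proof eventually_elim
  case (elim t)
  let ?H = "tail_fun M X0 \<bar>t\<bar>" and ?S = "S_alpha M F0 X n \<bar>t\<bar>"
  have int: "integrable M (\<lambda>\<omega>. \<bar>D n t \<omega>\<bar>)" "integrable M (\<lambda>\<omega>. (D n t \<omega>)\<^sup>2)"
    using abs_D_le[of n t] by (auto intro!: integrable_const_bound[where B = 1] simp: abs_square_le_1)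
  have "expectation (\<lambda>\<omega>. \<bar>D n t \<omega>\<bar>) = expectation (\<lambda>\<omega>. \<bar>\<Sum>k=1..n. Z t k \<omega>\<bar>) / real n"
    by (simp add: D_def)
  also have "\<dots> \<le> real n * (2 * (F t * (1 - F t))) / real n"
    by (intro divide_right_mono first_moment_le) simp
  finally have "expectation (\<lambda>\<omega>. \<bar>D n t \<omega>\<bar>) \<le> 2 * ?H"
    using elim assms by simp
  moreover have "expectation (\<lambda>\<omega>. \<bar>D n t \<omega>\<bar>) \<le> 2 * sqrt (?S / real n)"
  proof (rule power2_le_imp_le)
    \<comment> \<open>Jensen's inequality for the square, read off from a nonnegative
      variance.\<close>
    have "0 \<le> variance (\<lambda>\<omega>. \<bar>D n t \<omega>\<bar>)"
      by simp
    then have "(expectation (\<lambda>\<omega>. \<bar>D n t \<omega>\<bar>))\<^sup>2 \<le> expectation (\<lambda>\<omega>. (D n t \<omega>)\<^sup>2)"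
      using int by (subst (asm) variance_eq) auto
    also have "\<dots> \<le> 2 * (?S / real n)"
      using elim by simp
    \<comment> \<open>The constant is relaxed from the root of 2 to 2, to agree with the factor in
      front of the tail.\<close>
    also have "\<dots> \<le> (2 * sqrt (?S / real n))\<^sup>2"
      using S_alpha_nonneg[of n "\<bar>t\<bar>"]
      by (auto simp: power_mult_distrib intro!: divide_right_mono)
    finally show "(expectation (\<lambda>\<omega>. \<bar>D n t \<omega>\<bar>))\<^sup>2 \<le> (2 * sqrt (?S / real n))\<^sup>2" .
  qed (simp add: S_alpha_nonneg)
  \<comment> \<open>The root is monotone, so it commutes with the minimum, and it undoes the square
    of the nonnegative tail.\<close>
  moreover have "sqrt (min (?H\<^sup>2) (?S / real n)) = min ?H (sqrt (?S / real n))"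
    by (simp add: min_of_mono[symmetric] monoI tail_fun_def)
  ultimately show ?case
    by (simp add: min_def)
qed

section \<open>Integration over the thresholds: the two bounds\<close>

lemma nn_integral_W1_le:
  assumes "n \<ge> 1"
  shows "(\<integral>\<^sup>+ \<omega>. W1 (empirical_measure X n \<omega>) (distr M borel X0) \<partial>M)
    \<le> 4 * (\<integral>\<^sup>+ t\<in>{0..}. ennreal (sqrt (min ((tail_fun M X0 t)\<^sup>2) (S_alpha M F0 X n t / real n))) \<partial>lborel)"
proof -
  interpret PL: pair_sigma_finite M lborel ..
  let ?\<phi> = "\<lambda>t. sqrt (min ((tail_fun M X0 t)\<^sup>2) (S_alpha M F0 X n t / real n))"
  have int: "integrable M (\<lambda>\<omega>. \<bar>D n t \<omega>\<bar>)" for t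
    using abs_D_le[of n t] by (auto intro!: integrable_const_bound[where B = 1])
  have "(\<integral>\<^sup>+ \<omega>. W1 (empirical_measure X n \<omega>) (distr M borel X0) \<partial>M)
      \<le> (\<integral>\<^sup>+ \<omega>. \<integral>\<^sup>+ t. ennreal \<bar>D n t \<omega>\<bar> \<partial>lborel \<partial>M)"
    \<comment> \<open>Monotonicity of the integral asks no measurability of the distance as a
      function of \<omega>; the exchange of integrals is applied to the jointly measurable
      \<open>D\<close>.\<close>
    by (intro nn_integral_mono W1_empirical_measure_le assms)
  also have "\<dots> = (\<integral>\<^sup>+ t. \<integral>\<^sup>+ \<omega>. ennreal \<bar>D n t \<omega>\<bar> \<partial>M \<partial>lborel)"
    by (rule PL.Fubini'[symmetric]) measurable
  also have "\<dots> = (\<integral>\<^sup>+ t. ennreal (expectation (\<lambda>\<omega>. \<bar>D n t \<omega>\<bar>)) \<partial>lborel)"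
    by (simp add: nn_integral_eq_integral[OF int])
  also have "\<dots> \<le> (\<integral>\<^sup>+ t. 2 * ennreal (?\<phi> \<bar>t\<bar>) \<partial>lborel)"
    using AE_expectation_abs_D_le[OF assms]
    by (intro nn_integral_mono_AE)
      (auto elim!: eventually_mono dest!: ennreal_leI simp: ennreal_mult' S_alpha_nonneg)
  \<comment> \<open>The constant 4 is the pointwise factor 2 times the factor 2 from folding the
    line.\<close>
  also have "\<dots> = 2 * (2 * (\<integral>\<^sup>+ t\<in>{0..}. ennreal (?\<phi> t) \<partial>lborel))"
    by (subst nn_integral_cmult) (simp_all add: nn_integral_even[of "\<lambda>t. ennreal (?\<phi> t)"])
  finally show ?thesis
    by (simp add: mult.assoc[symmetric])
qed

text \<open>At almost every \<open>t\<close>, \<open>?b\<close> at the absolute value of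
  \<open>t\<close> bounds the root mean square of the deviation \<open>D n t\<close>. The integral
  inequality of Minkowski turns these into a bound for the integrated deviation, which dominates the
  distance.\<close>

lemma L2_norm_W1_le:
  assumes "n \<ge> 1"
  shows "L2_norm_nn M (\<lambda>\<omega>. W1 (empirical_measure X n \<omega>) (distr M borel X0))
    \<le> ennreal (2 * sqrt 2 / sqrt (real n)) * (\<integral>\<^sup>+ t\<in>{0..}. ennreal (sqrt (S_alpha M F0 X n t)) \<partial>lborel)"
proof -
  let ?b = "\<lambda>t. ennreal (sqrt (2 / real n)) * ennreal (sqrt (S_alpha M F0 X n t))"
  have int: "integrable M (\<lambda>\<omega>. (D n t \<omega>)\<^sup>2)" for t
    using abs_D_le[of n t] by (auto intro!: integrable_const_bound[where B = 1] simp: abs_square_le_1)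
  have b: "AE t in lborel. (\<integral>\<^sup>+ \<omega>. (ennreal \<bar>D n t \<omega>\<bar>)\<^sup>2 \<partial>M) \<le> (?b \<bar>t\<bar>)\<^sup>2"
    using AE_expectation_D_square_le[OF assms]
  proof eventually_elim
    case (elim t)
    have "(\<integral>\<^sup>+ \<omega>. (ennreal \<bar>D n t \<omega>\<bar>)\<^sup>2 \<partial>M) = ennreal (expectation (\<lambda>\<omega>. (D n t \<omega>)\<^sup>2))"
      by (simp add: ennreal_power nn_integral_eq_integral[OF int])
    also have "\<dots> \<le> ennreal (2 / real n * S_alpha M F0 X n \<bar>t\<bar>)"
      using elim by (intro ennreal_leI) simp
    also have "\<dots> = (?b \<bar>t\<bar>)\<^sup>2"
      using S_alpha_nonneg[of n "\<bar>t\<bar>"]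
      by (simp add: power_mult_distrib ennreal_power flip: ennreal_mult')
    finally show ?case .
  qed
  have "(\<integral>\<^sup>+ \<omega>. (W1 (empirical_measure X n \<omega>) (distr M borel X0))\<^sup>2 \<partial>M)
      \<le> (\<integral>\<^sup>+ \<omega>. (\<integral>\<^sup>+ t. ennreal \<bar>D n t \<omega>\<bar> \<partial>lborel)\<^sup>2 \<partial>M)"
    by (intro nn_integral_mono power_mono W1_empirical_measure_le assms) simp
  also have "\<dots> \<le> (\<integral>\<^sup>+ t. ?b \<bar>t\<bar> \<partial>lborel)\<^sup>2"
    using b by (intro nn_integral_square_nn_integral_le) (auto simp: sigma_finite_measure_axioms lborel.sigma_finite_measure_axioms)
  \<comment> \<open>The root is taken only now; \<open>ennreal_sqrt\<close> is monotone and inverts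
    the square also at infinity.\<close>
  finally have "L2_norm_nn M (\<lambda>\<omega>. W1 (empirical_measure X n \<omega>) (distr M borel X0))
      \<le> (\<integral>\<^sup>+ t. ?b \<bar>t\<bar> \<partial>lborel)"
    unfolding L2_norm_nn_def by (metis ennreal_sqrt_mono ennreal_sqrt_power2)
  also have "\<dots> = ennreal (sqrt (2 / real n)) * (2 * (\<integral>\<^sup>+ t\<in>{0..}. ennreal (sqrt (S_alpha M F0 X n t)) \<partial>lborel))"
    by (subst nn_integral_cmult) (simp_all add: nn_integral_even[of "\<lambda>t. ennreal (sqrt (S_alpha M F0 X n t))"])
  also have "\<dots> = ennreal (2 * sqrt 2 / sqrt (real n)) * (\<integral>\<^sup>+ t\<in>{0..}. ennreal (sqrt (S_alpha M F0 X n t)) \<partial>lborel)"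
  proof -
    have "ennreal (2 * sqrt 2 / sqrt (real n)) = ennreal (sqrt (2 / real n)) * 2"
      by (simp add: real_sqrt_divide ennreal_mult'[symmetric] mult.commute flip: ennreal_numeral)
    then show ?thesis
      by (simp add: mult.assoc)
  qed
  finally show ?thesis .
qed

end

theorem proposition3p2:
  fixes M F0 :: "'a measure"
    and T :: "'a \<Rightarrow> 'a"
    and X0 :: "'a \<Rightarrow> real"
    and X :: "int \<Rightarrow> 'a \<Rightarrow> real"
    and \<mu> :: "real measure"
    and n :: nat
  assumes "prob_space M"
    and "bimeasurable_preserving M T"
    and "subalgebra M F0"
    and "sets F0 \<subseteq> {T -` B \<inter> space M | B. B \<in> sets F0}"
    and "X0 \<in> borel_measurable F0"
    and "integrable M X0"
    and "\<mu> = distr M borel X0"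
    and "X = (\<lambda>i. X0 \<circ> int_iterate M T i)"
    and "n \<ge> 1"
  shows "(\<integral>\<^sup>+ \<omega>. W1 (empirical_measure X n \<omega>) \<mu> \<partial>M)
           \<le> 4 * (\<integral>\<^sup>+ t\<in>{0..}. ennreal (sqrt (min ((tail_fun M X0 t)\<^sup>2)
                                                     (S_alpha M F0 X n t / real n))) \<partial>lborel)
       \<and> L2_norm_nn M (\<lambda>\<omega>. W1 (empirical_measure X n \<omega>) \<mu>)
           \<le> ennreal (2 * sqrt 2 / sqrt (real n)) *
              (\<integral>\<^sup>+ t\<in>{0..}. ennreal (sqrt (S_alpha M F0 X n t)) \<partial>lborel)"
proof -
  interpret prob_space M by fact
  \<comment> \<open>At a nonnegative index \<open>int_iterate\<close> is an ordinary power of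
    \<open>T\<close>, which is the description of \<open>X\<close> that the locale asks for.\<close>
  interpret stationary_orbit M F0 T X0 X
    using assms
    by unfold_locales (simp_all add: bimeasurable_preserving_def int_iterate_def)
  show ?thesis
    unfolding \<open>\<mu> = distr M borel X0\<close>
    using nn_integral_W1_le[OF \<open>n \<ge> 1\<close>] L2_norm_W1_le[OF \<open>n \<ge> 1\<close>] by blast
qed

end
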